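(* Let $M$ be a real symmetric $n\times n$ matrix with $M_{ii}+M_{jj}\le 2M_{ij}$ for all $i,j$. Then the symmetric Barvinok rank of $M$ is at most $\max\{n,\lfloor n^2/4\rfloor\}$, and this bound is tight (for each $n$ there is such a matrix whose symmetric Barvinok rank equals $\max\{n,\lfloor n^2/4\rfloor\}$). Consequently every real symmetric $n\times n$ matrix of finite symmetric Barvinok rank has symmetric Barvinok rank at most $\max\{n,\lfloor n^2/4\rfloor\}$.
   Context: For $v\in\mathbb{R}^n$, $v^T\odot v$ is the symmetric matrix with entries $v_i+v_j$. The symmetric Barvinok rank of a real symmetric matrix $M$ is the smallest $r$ such that $M$ is the coordinatewise minimum of $r$ matrices of the form $v^T\odot v$, or $\infty$ if none exists. *)

theory Defs
  imports "HOL-Analysis.Analysis" "HOL-Library.Extended_Nat"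
begin

text \<open>The tropical outer square of \<open>v\<close>: the tropical product of a column and a row is the
  matrix of sums.\<close>

definition tropical_outer :: "real ^ 'n \<Rightarrow> real ^ 'n ^ 'n" where
  "tropical_outer v = (\<chi> i j. v $ i + v $ j)"

definition entrywise_min :: "nat \<Rightarrow> (nat \<Rightarrow> real ^ 'n ^ 'm) \<Rightarrow> real ^ 'n ^ 'm" where
  "entrywise_min r A = (\<chi> i j. Min ((\<lambda>k. A k $ i $ j) ` {..<r}))"

text \<open>The guard \<open>1 \<le> r\<close> is needed because \<open>entrywise_min 0\<close> is meaningless: the empty
  coordinatewise minimum would have infinite entries and is not a real matrix. The infimum
  of the empty set in \<^typ>\<open>enat\<close> is \<open>\<infinity>\<close>.\<close>

definition symmetric_barvinok_rank :: "real ^ 'n ^ 'n \<Rightarrow> enat" where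
  "symmetric_barvinok_rank M =
     Inf {enat r | r. 1 \<le> r \<and>
            (\<exists>v :: nat \<Rightarrow> real ^ 'n. M = entrywise_min r (\<lambda>k. tropical_outer (v k)))}"

end

theory Submission
  imports Defs
begin

text \<open>Subtracting half the diagonal from rows and columns reduces to a nonnegative matrix \<open>m\<close> with zero
  diagonal, for which vectors \<open>f\<close> with \<open>m i j \<le> f i + f j\<close> have to be found that attain equality
  at every entry. For a smallest off-diagonal entry \<open>m i j\<close>, every other index \<open>l\<close> has a vector
  that vanishes at \<open>l\<close> and is tight at \<open>(i, l)\<close> and \<open>(j, l)\<close>. Replacing this vector by two for a
  single index \<open>k\<close> makes \<open>(i, j)\<close>, \<open>(i, i)\<close>, \<open>(j, j)\<close> tight as well, so that \<open>n - 1\<close> vectors handle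
  all entries in the rows \<open>i, j\<close> and all diagonal entries except \<open>(k, k)\<close>; one recurses on the
  remaining \<open>n - 2\<close> indices. Tightness of the bound comes from the zero-one matrices whose
  zero graph is a balanced complete bipartite graph or, for \<open>n \<le> 4\<close>, has no edges.\<close>

section \<open>Upper bound: covers of a nonnegative matrix with zero diagonal\<close>

locale zero_diagonal_matrix =
  fixes m :: "'a \<Rightarrow> 'a \<Rightarrow> real" and B :: real
  assumes sym: "m i j = m j i"
    and diag: "m i i = 0"
    and nonneg: "0 \<le> m i j"
    and bound: "m i j \<le> B"
begin

definition dominating :: "('a \<Rightarrow> real) \<Rightarrow> bool" where
  "dominating f \<longleftrightarrow> (\<forall>i j. m i j \<le> f i + f j)"

definition tight_at :: "('a \<Rightarrow> real) set \<Rightarrow> 'a \<Rightarrow> 'a \<Rightarrow> bool" where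
  "tight_at F i j \<longleftrightarrow> (\<exists>f\<in>F. f i + f j = m i j)"

lemma tight_at_commute: "tight_at F i j \<longleftrightarrow> tight_at F j i"
  unfolding tight_at_def sym[of j i] by (simp add: add.commute)

lemma tight_at_mono: "tight_at F i j \<Longrightarrow> F \<subseteq> G \<Longrightarrow> tight_at G i j"
  by (auto simp: tight_at_def)

lemma bound_nonneg: "0 \<le> B"
  using order_trans[OF nonneg bound] .

lemma le_bound_add:
  "m x y \<le> 2 * B" "0 \<le> d \<Longrightarrow> m x y \<le> B + d" "0 \<le> d \<Longrightarrow> m x y \<le> d + B"
  using bound[of x y] bound_nonneg by linarith+

text \<open>A coordinate equal to the default value \<open>B\<close> already dominates when paired
  with any nonnegative coordinate, so only the entries among the prescribed indices need
  checking.\<close>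

lemma dominating_upd3:
  assumes "i \<noteq> j" "i \<noteq> k" "j \<noteq> k" "0 \<le> a" "0 \<le> b" "0 \<le> c"
    and "m i j \<le> a + b" "m i k \<le> a + c" "m j k \<le> b + c"
  shows "dominating ((\<lambda>_. B)(i := a, j := b, k := c))"
proof -
  have "m j i \<le> b + a" "m k i \<le> c + a" "m k j \<le> c + b"
    using assms by (simp_all add: sym[of j i] sym[of k i] sym[of k j] add.commute)
  then show ?thesis
    unfolding dominating_def using assms by (auto simp: diag le_bound_add)
qed

lemma dominating_upd2:
  assumes "i \<noteq> j" "0 \<le> a" "0 \<le> b" "m i j \<le> a + b"
  shows "dominating ((\<lambda>_. B)(i := a, j := b))"
proof -
  have "m j i \<le> b + a"
    using assms by (simp add: sym[of j i] add.commute)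
  then show ?thesis
    unfolding dominating_def using assms by (auto simp: diag le_bound_add)
qed

lemma dominating_upd1: "dominating ((\<lambda>_. B)(i := 0))"
  unfolding dominating_def by (auto simp: diag le_bound_add bound)

text \<open>Two vectors serve all entries on three indices except \<open>(k, k)\<close>. One
  vanishes at \<open>i\<close> and the other at \<open>j\<close>; whether the row of
  \<open>i\<close> can be tight in a single vector depends on the triangle inequality for
  \<open>m j k\<close>.\<close>

lemma exists_triple_cover:
  assumes d: "i \<noteq> j" "i \<noteq> k" "j \<noteq> k"
  shows "\<exists>f g. dominating f \<and> dominating g \<and>
    tight_at {f, g} i j \<and> tight_at {f, g} i k \<and> tight_at {f, g} j k \<and>
    tight_at {f, g} i i \<and> tight_at {f, g} j j"
  using d
proof (induction "m i k" "m j k" arbitrary: i j rule: linorder_wlog)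
  case (sym i j)
  from sym(1)[of j i] sym(2-4) show ?case
    by (simp add: tight_at_commute) blast
next
  case (le i j)
  show ?case
  proof (cases "m j k \<le> m i j + m i k")
    case True
    let ?f = "(\<lambda>_. B)(i := 0, j := m i j, k := m i k)"
    let ?g = "(\<lambda>_. B)(j := 0, k := m j k)"
    have "dominating ?f" "dominating ?g"
      using le True nonneg by (auto intro!: dominating_upd3 dominating_upd2)
    then show ?thesis
      by (intro exI[of _ ?f] exI[of _ ?g]) (use le in \<open>auto simp: tight_at_def diag\<close>)
  next
    case False
    \<comment> \<open>Being tight at both \<open>(i, j)\<close> and \<open>(i, k)\<close> would fall
      short at \<open>(j, k)\<close>. So the coordinate at \<open>j\<close> is raised until
      \<open>(j, k)\<close> is tight, which exceeds \<open>m i j\<close>, and \<open>?g\<close>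
      takes over \<open>(i, j)\<close>.\<close>
    let ?f = "(\<lambda>_. B)(i := 0, j := m j k - m i k, k := m i k)"
    let ?g = "(\<lambda>_. B)(i := m i j, j := 0)"
    have "dominating ?f" "dominating ?g"
      using le False nonneg by (auto intro!: dominating_upd3 dominating_upd2)
    then show ?thesis
      by (intro exI[of _ ?f] exI[of _ ?g]) (use le in \<open>auto simp: tight_at_def diag\<close>)
  qed
qed

text \<open>The triple cover spends two vectors on \<open>i, j, k\<close>, and each of the other
  \<open>card S - 3\<close> indices costs one. The assumption \<open>le\<close> is what makes that
  one vector dominate at \<open>(i, j)\<close>. The entry \<open>(k, k)\<close> is left out because
  the triple cover leaves it out.\<close>

lemma exists_two_row_cover:
  assumes S: "finite S" "i \<in> S" "j \<in> S" "k \<in> S"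
    and d: "i \<noteq> j" "i \<noteq> k" "j \<noteq> k"
    and le: "\<And>l. l \<in> S - {i, j, k} \<Longrightarrow> m i j \<le> m i l + m j l"
  shows "\<exists>F. finite F \<and> card F \<le> card S - 1 \<and> (\<forall>f\<in>F. dominating f) \<and>
    (\<forall>x\<in>{i, j}. \<forall>y\<in>S. tight_at F x y) \<and> (\<forall>x\<in>S - {k}. tight_at F x x)"
proof -
  obtain f g where fg: "dominating f" "dominating g"
    "tight_at {f, g} i j" "tight_at {f, g} i k" "tight_at {f, g} j k"
    "tight_at {f, g} i i" "tight_at {f, g} j j"
    using exists_triple_cover[OF d] by blast
  define h where "h l = (\<lambda>_. B)(i := m i l, j := m j l, l := 0)" for l
  define F where "F = {f, g} \<union> h ` (S - {i, j, k})"
  have "card {i, j, k} = 3"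
    using d by auto
  moreover have "card {i, j, k} \<le> card S"
    using S by (intro card_mono) auto
  ultimately have "3 \<le> card S" "card (S - {i, j, k}) = card S - 3"
    using S by (simp_all add: card_Diff_subset)
  moreover have "card F \<le> card {f, g} + card (h ` (S - {i, j, k}))"
    unfolding F_def by (rule card_Un_le)
  moreover have "card {f, g} \<le> 2"
    by (simp add: card_insert_if)
  moreover have "card (h ` (S - {i, j, k})) \<le> card (S - {i, j, k})"
    using S by (intro card_image_le) auto
  ultimately have card: "card F \<le> card S - 1"
    by linarith
  have "dominating (h l)" if "l \<in> S - {i, j, k}" for l
    unfolding h_def using that d le nonneg by (intro dominating_upd3) auto
  then have dom: "\<forall>f\<in>F. dominating f"
    using fg by (auto simp: F_def)
  have fgF: "tight_at F x y" if "tight_at {f, g} x y" for x y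
    using that by (rule tight_at_mono) (auto simp: F_def)
  have other: "tight_at F i l" "tight_at F j l" "tight_at F l l" if "l \<in> S - {i, j, k}" for l
  proof -
    have "h l \<in> F"
      using that by (simp add: F_def)
    moreover have "h l i = m i l" "h l j = m j l" "h l l = 0"
      using that d by (auto simp: h_def)
    ultimately show "tight_at F i l" "tight_at F j l" "tight_at F l l"
      unfolding tight_at_def by (auto simp: diag intro!: bexI[of _ "h l"])
  qed
  have "tight_at F j i"
    using fgF fg(3) tight_at_commute by blast
  then have "tight_at F i y" "tight_at F j y" if "y \<in> S" for y
    using that fg fgF other[of y] by blast+
  moreover have "tight_at F x x" if "x \<in> S - {k}" for x
    using that fg fgF other[of x] by blast
  ultimately show ?thesis
    using card dom S by (intro exI[of _ F]) (auto simp: F_def)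
qed

text \<open>Small index sets need \<open>card S\<close> vectors to be tight on the whole diagonal, which would spoil
  the recursion; requiring a single diagonal entry \<open>(c, c)\<close> is all that the recursion needs.\<close>

lemma exists_cover_quarter_square:
  assumes "finite S" "2 \<le> card S" "c \<in> S"
  shows "\<exists>F. finite F \<and> card F \<le> card S ^ 2 div 4 \<and> (\<forall>f\<in>F. dominating f) \<and>
    (\<forall>x\<in>S. \<forall>y\<in>S. x \<noteq> y \<longrightarrow> tight_at F x y) \<and> tight_at F c c \<and>
    (4 \<le> card S \<longrightarrow> (\<forall>x\<in>S. tight_at F x x))"
  using assms
proof (induction "card S" arbitrary: S c rule: less_induct)
  case less
  consider "card S = 2" | "card S = 3" | "4 \<le> card S"
    using less.prems by linarith
  then show ?case
  proof cases
    case 1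
    then have "card (S - {c}) = 1"
      using less.prems by simp
    then obtain a where "S - {c} = {a}"
      by (auto simp: card_1_singleton_iff)
    then have S: "S = {c, a}" "a \<noteq> c"
      using less.prems by blast+
    let ?f = "(\<lambda>_. B)(c := 0, a := m c a)"
    have "dominating ?f"
      using S nonneg by (intro dominating_upd2) auto
    then show ?thesis
      using S by (intro exI[of _ "{?f}"]) (auto simp: tight_at_def diag sym[of a c] power2_eq_square)
  next
    case 2
    then have "card (S - {c}) = 2"
      using less.prems by simp
    then obtain a b where ab: "S - {c} = {a, b}" "a \<noteq> b"
      by (auto simp: card_2_iff)
    then have S: "S = {c, a, b}" "a \<noteq> b" "c \<noteq> a" "c \<noteq> b"
      using less.prems by blast+
    \<comment> \<open>With \<open>c\<close> as one of the two rows, the diagonal entry missed is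
      \<open>(b, b)\<close>; the count 2 equals 9 div 4.\<close>
    obtain F where F: "finite F" "card F \<le> card S - 1" "\<forall>f\<in>F. dominating f"
      "\<forall>x\<in>{c, a}. \<forall>y\<in>S. tight_at F x y" "\<forall>x\<in>S - {b}. tight_at F x x"
      using exists_two_row_cover[of S c a b] S by auto
    have "tight_at F x y" if "x \<in> S" "y \<in> S" "x \<noteq> y" for x y
    proof (cases "x = b")
      case True
      then have "tight_at F y x"
        using F(4) S(1) that by blast
      then show ?thesis
        using tight_at_commute by blast
    next
      case False
      then show ?thesis
        using F(4) S(1) that by blast
    qed
    moreover have "tight_at F c c"
      using F(5) S by blast
    moreover have "card F \<le> card S ^ 2 div 4"
      using F(2) 2 by simp
    ultimately show ?thesis
      using F(1,3) 2 by (intro exI[of _ F]) simp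
  next
    case 3
    define P where "P = {(x, y). x \<in> S \<and> y \<in> S \<and> x \<noteq> y}"
    have "finite P"
      by (rule finite_subset[of _ "S \<times> S"]) (use less.prems in \<open>auto simp: P_def\<close>)
    moreover have "P \<noteq> {}"
    proof
      assume "P = {}"
      then have "S \<subseteq> {c}"
        using less.prems by (auto simp: P_def)
      then have "card S \<le> 1"
        using card_mono[of "{c}" S] by simp
      with 3 show False
        by simp
    qed
    ultimately obtain p where "is_arg_min (case_prod m) (\<lambda>p. p \<in> P) p"
      using ex_is_arg_min_if_finite by blast
    then obtain i j where ij: "i \<in> S" "j \<in> S" "i \<noteq> j"
      and min: "\<And>x y. x \<in> S \<Longrightarrow> y \<in> S \<Longrightarrow> x \<noteq> y \<Longrightarrow> m i j \<le> m x y"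
      by (cases p) (auto simp: is_arg_min_linorder P_def)
    define T where "T = S - {i, j}"
    have T: "finite T" "card T = card S - 2"
      using ij less.prems by (auto simp: T_def card_Diff_subset)
    then have "T \<noteq> {}"
      using 3 by auto
    then obtain k where k: "k \<in> T"
      by blast
    obtain F where F: "finite F" "card F \<le> card S - 1" "\<forall>f\<in>F. dominating f"
      "\<forall>x\<in>{i, j}. \<forall>y\<in>S. tight_at F x y" "\<forall>x\<in>S - {k}. tight_at F x x"
    proof -
      have "m i j \<le> m i l + m j l" if "l \<in> S - {i, j, k}" for l
        using min[of i l] ij that nonneg[of j l] by auto
      then show thesis
        using exists_two_row_cover[of S i j k] that less.prems ij k by (auto simp: T_def)
    qed
    have "card T < card S" "2 \<le> card T"
      using T 3 by linarith+
    \<comment> \<open>The recursive call uses \<open>k\<close> as its distinguished index, so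
      \<open>G\<close> supplies the one diagonal entry of \<open>S\<close> that \<open>F\<close> may
      miss on small \<open>T\<close>.\<close>
    from less.hyps[OF this(1) T(1) this(2) k] obtain G where G: "finite G" "card G \<le> card T ^ 2 div 4" "\<forall>f\<in>G. dominating f"
      "\<forall>x\<in>T. \<forall>y\<in>T. x \<noteq> y \<longrightarrow> tight_at G x y" "tight_at G k k"
      by (elim exE conjE) (rule that)
    have "card (F \<union> G) \<le> card S ^ 2 div 4"
    proof -
      obtain n where n: "card S = n + 2"
        using less.prems(2) le_add_diff_inverse2 by metis
      \<comment> \<open>Passing from \<open>n\<close> to \<open>n + 2\<close> indices raises the
        bound by exactly \<open>n + 1\<close>, the number of vectors allowed in
        \<open>F\<close>.\<close>
      have "(n + 2) ^ 2 = n ^ 2 + 4 * (n + 1)"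
        by (simp add: power2_eq_square algebra_simps)
      then have "(n + 2) ^ 2 div 4 = n ^ 2 div 4 + (n + 1)"
        by simp
      then show ?thesis
        using card_Un_le[of F G] F(2) G(2) T n by simp
    qed
    moreover have "tight_at (F \<union> G) x y" if xy: "x \<in> S" "y \<in> S" for x y
    proof -
      consider "x \<in> {i, j}" | "y \<in> {i, j}" | "x = y" "x \<noteq> k" | "x = y" "x = k"
        | "x \<in> T" "y \<in> T" "x \<noteq> y"
        using xy unfolding T_def by blast
      then have "tight_at F x y \<or> tight_at F y x \<or> tight_at G x y"
        by cases (use F(4,5) G(4,5) xy in blast)+
      then show ?thesis
        by (metis tight_at_commute tight_at_mono Un_upper1 Un_upper2)
    qed
    moreover have "\<forall>f\<in>F \<union> G. dominating f"
      using F(3) G(3) by blast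
    ultimately show ?thesis
      using F(1) G(1) less.prems(3) by (intro exI[of _ "F \<union> G"]) simp
  qed
qed

text \<open>From four indices on, the quarter square cover is tight on the whole diagonal. Below
  that, the missing diagonal entries are paid for separately, for a total of at most
  \<open>card S\<close>.\<close>

lemma exists_cover:
  assumes "finite S" "S \<noteq> {}"
  shows "\<exists>F. finite F \<and> card F \<le> max (card S) (card S ^ 2 div 4) \<and> (\<forall>f\<in>F. dominating f) \<and>
    (\<forall>x\<in>S. \<forall>y\<in>S. tight_at F x y)"
proof -
  have "0 < card S"
    using assms by (simp add: card_gt_0_iff)
  then consider "card S = 1" | "card S = 2" | "card S = 3" | "4 \<le> card S"
    by linarith
  then show ?thesis
  proof cases
    case 1
    then obtain a where "S = {a}"
      by (auto simp: card_1_singleton_iff)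
    then show ?thesis
      using dominating_upd1[of a]
      by (intro exI[of _ "{(\<lambda>_. B)(a := 0)}"]) (auto simp: tight_at_def diag)
  next
    case 2
    then obtain a b where S: "S = {a, b}" "a \<noteq> b"
      by (auto simp: card_2_iff)
    let ?f = "(\<lambda>_. B)(a := 0, b := m a b)" and ?g = "(\<lambda>_. B)(b := 0)"
    have "dominating ?f" "dominating ?g"
      using S nonneg by (auto intro!: dominating_upd2 dominating_upd1)
    moreover have "card {?f, ?g} \<le> 2"
      by (simp add: card_insert_if)
    ultimately show ?thesis
      using S by (intro exI[of _ "{?f, ?g}"]) (auto simp: tight_at_def diag sym[of b a])
  next
    case 3
    then obtain a b c where S: "S = {a, b, c}" "a \<noteq> b" "b \<noteq> c" "a \<noteq> c"
      by (auto simp: card_3_iff)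
    obtain F where F: "finite F" "card F \<le> card S - 1" "\<forall>f\<in>F. dominating f"
      "\<forall>x\<in>{a, b}. \<forall>y\<in>S. tight_at F x y"
      using exists_two_row_cover[of S a b c] S by auto
    \<comment> \<open>Only \<open>(c, c)\<close> is not yet known to be tight.\<close>
    let ?g = "(\<lambda>_. B)(c := 0)"
    have "tight_at (insert ?g F) x y" if "x \<in> S" "y \<in> S" for x y
    proof (cases "x = c \<and> y = c")
      case True
      then show ?thesis
        by (simp add: tight_at_def diag)
    next
      case False
      then have "tight_at F x y"
        using F(4) S that tight_at_commute by blast
      then show ?thesis
        by (rule tight_at_mono) auto
    qed
    moreover have "card (insert ?g F) \<le> 3"
      using F 3 by (simp add: card_insert_if)
    ultimately show ?thesis
      using F 3 dominating_upd1 by (intro exI[of _ "insert ?g F"]) auto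
  next
    case 4
    obtain c where "c \<in> S"
      using assms by blast
    then obtain F where "finite F" "card F \<le> card S ^ 2 div 4" "\<forall>f\<in>F. dominating f"
      "\<forall>x\<in>S. \<forall>y\<in>S. x \<noteq> y \<longrightarrow> tight_at F x y" "\<forall>x\<in>S. tight_at F x x"
      using exists_cover_quarter_square[of S c] assms 4 by auto
    then show ?thesis
      by (intro exI[of _ F]) fastforce
  qed
qed

end

section \<open>From covers to bounds on the symmetric Barvinok rank\<close>

lemma entrywise_min_tropical_outer_eq_iff:
  fixes M :: "real ^ 'n ^ 'n"
  assumes "1 \<le> r"
  shows "M = entrywise_min r (\<lambda>k. tropical_outer (v k)) \<longleftrightarrow>
    (\<forall>i j. (\<forall>k<r. M $ i $ j \<le> v k $ i + v k $ j) \<and> (\<exists>k<r. M $ i $ j = v k $ i + v k $ j))"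
proof -
  have "M $ i $ j = Min ((\<lambda>k. v k $ i + v k $ j) ` {..<r}) \<longleftrightarrow>
    (\<forall>k<r. M $ i $ j \<le> v k $ i + v k $ j) \<and> (\<exists>k<r. M $ i $ j = v k $ i + v k $ j)" for i j
    using assms by (subst eq_Min_iff) (auto simp: lessThan_empty_iff)
  then show ?thesis
    by (auto simp: vec_eq_iff entrywise_min_def tropical_outer_def)
qed

lemma symmetric_barvinok_rank_le:
  fixes M :: "real ^ 'n ^ 'n"
  assumes F: "finite F" "card F \<le> r"
    and dom: "\<And>f i j. f \<in> F \<Longrightarrow> M $ i $ j \<le> f $ i + f $ j"
    and tight: "\<And>i j. \<exists>f\<in>F. M $ i $ j = f $ i + f $ j"
  shows "symmetric_barvinok_rank M \<le> enat r"
proof -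
  obtain v :: "nat \<Rightarrow> real ^ 'n" where v: "bij_betw v {0..<card F} F"
    using ex_bij_betw_nat_finite[OF F(1)] by blast
  then have vF: "v ` {..<card F} = F"
    by (simp add: bij_betw_def atLeast0LessThan)
  have "F \<noteq> {}"
    using tight by blast
  then have "1 \<le> card F"
    using F(1) by (simp add: Suc_le_eq card_gt_0_iff)
  moreover have "M = entrywise_min (card F) (\<lambda>k. tropical_outer (v k))"
    unfolding entrywise_min_tropical_outer_eq_iff[OF \<open>1 \<le> card F\<close>]
  proof (intro allI conjI impI)
    fix i j k assume "k < card F"
    then show "M $ i $ j \<le> v k $ i + v k $ j"
      using vF by (intro dom) auto
  next
    fix i j
    obtain f where "f \<in> F" "M $ i $ j = f $ i + f $ j"
      using tight by blast
    moreover from this obtain k where "k < card F" "f = v k"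
      using vF by blast
    ultimately show "\<exists>k<card F. M $ i $ j = v k $ i + v k $ j"
      by blast
  qed
  ultimately have "symmetric_barvinok_rank M \<le> enat (card F)"
    unfolding symmetric_barvinok_rank_def by (intro Inf_lower) blast
  then show ?thesis
    using F(2) order_trans by fastforce
qed

lemma symmetric_barvinok_rank_le_quarter_square:
  fixes M :: "real ^ 'n ^ 'n"
  assumes M: "transpose M = M" "\<And>i j. M $ i $ i + M $ j $ j \<le> 2 * M $ i $ j"
  shows "symmetric_barvinok_rank M \<le> enat (max CARD('n) (CARD('n) ^ 2 div 4))"
proof -
  define m where "m i j = M $ i $ j - (M $ i $ i + M $ j $ j) / 2" for i j
  define B where "B = Max (case_prod m ` UNIV)"
  interpret zero_diagonal_matrix m B
  proof
    fix i j
    have "M $ i $ j = M $ j $ i"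
      using M(1) by (metis transpose_def vec_lambda_beta)
    then show "m i j = m j i"
      by (simp add: m_def add.commute)
    show "m i i = 0"
      by (simp add: m_def)
    show "0 \<le> m i j"
      using M(2)[of i j] by (simp add: m_def)
    show "m i j \<le> B"
      unfolding B_def by (rule Max_ge) (auto intro: image_eqI[of _ _ "(i, j)"])
  qed
  obtain F where F: "finite F" "card F \<le> max CARD('n) (CARD('n) ^ 2 div 4)"
    "\<forall>f\<in>F. dominating f" "\<forall>i j. tight_at F i j"
    using exists_cover[of UNIV] by auto
  \<comment> \<open>Restoring half the diagonal keeps the slack at every entry, hence both
    domination and tightness.\<close>
  define w :: "('n \<Rightarrow> real) \<Rightarrow> real ^ 'n" where "w f = (\<chi> i. f i + M $ i $ i / 2)" for f
  have w: "w f $ i + w f $ j - M $ i $ j = f i + f j - m i j" for f i j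
    by (simp add: w_def m_def field_simps)
  show ?thesis
  proof (rule symmetric_barvinok_rank_le)
    show "finite (w ` F)"
      using F(1) by simp
    show "card (w ` F) \<le> max CARD('n) (CARD('n) ^ 2 div 4)"
      using card_image_le[OF F(1), of w] F(2) by linarith
    show "M $ i $ j \<le> f $ i + f $ j" if f: "f \<in> w ` F" for f i j
    proof -
      obtain g where g: "g \<in> F" "f = w g"
        using f by blast
      then have "m i j \<le> g i + g j"
        using F(3) by (auto simp: dominating_def)
      then show ?thesis
        using w[of g i j] g(2) by simp
    qed
    show "\<exists>f\<in>w ` F. M $ i $ j = f $ i + f $ j" for i j
    proof -
      obtain g where g: "g \<in> F" "g i + g j = m i j"
        using F(4) by (auto simp: tight_at_def)
      then have "M $ i $ j = w g $ i + w g $ j"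
        using w[of g i j] by linarith
      then show ?thesis
        using g by blast
    qed
  qed
qed

text \<open>The vector attaining the minimum at \<open>(i, j)\<close> also bounds the two diagonal
  entries, by twice its coordinates.\<close>

lemma diagonal_le_of_symmetric_barvinok_rank_finite:
  fixes M :: "real ^ 'n ^ 'n"
  assumes "symmetric_barvinok_rank M < \<infinity>"
  shows "M $ i $ i + M $ j $ j \<le> 2 * M $ i $ j"
proof -
  obtain r and v :: "nat \<Rightarrow> real ^ 'n" where r: "1 \<le> r"
    and M: "M = entrywise_min r (\<lambda>k. tropical_outer (v k))"
    using assms unfolding symmetric_barvinok_rank_def Inf_less_iff by blast
  obtain k where "k < r" "M $ i $ j = v k $ i + v k $ j"
    "M $ i $ i \<le> v k $ i + v k $ i" "M $ j $ j \<le> v k $ j + v k $ j"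
    using M unfolding entrywise_min_tropical_outer_eq_iff[OF r] by blast
  then show ?thesis
    by linarith
qed

text \<open>A fooling set argument: no dominating vector is tight at two members of
  \<open>T\<close>, so choosing a tight vector for each member is injective.\<close>

lemma symmetric_barvinok_rank_ge:
  fixes M :: "real ^ 'n ^ 'n"
  assumes separate: "\<And>p q v. p \<in> T \<Longrightarrow> q \<in> T \<Longrightarrow> \<forall>i j. M $ i $ j \<le> v $ i + v $ j \<Longrightarrow>
      M $ fst p $ snd p = v $ fst p + v $ snd p \<Longrightarrow>
      M $ fst q $ snd q = v $ fst q + v $ snd q \<Longrightarrow> p = q"
  shows "enat (card T) \<le> symmetric_barvinok_rank M"
  unfolding symmetric_barvinok_rank_def
proof (rule Inf_greatest, clarify)
  fix r and v :: "nat \<Rightarrow> real ^ 'n"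
  assume r: "1 \<le> r" and "M = entrywise_min r (\<lambda>k. tropical_outer (v k))"
  then have dom: "\<And>i j k. k < r \<Longrightarrow> M $ i $ j \<le> v k $ i + v k $ j"
    and tight: "\<And>i j. \<exists>k<r. M $ i $ j = v k $ i + v k $ j"
    unfolding entrywise_min_tropical_outer_eq_iff[OF r] by blast+
  obtain \<kappa> where \<kappa>: "\<And>p. \<kappa> p < r"
    "\<And>p. M $ fst p $ snd p = v (\<kappa> p) $ fst p + v (\<kappa> p) $ snd p"
    using choice[of "\<lambda>p k. k < r \<and> M $ fst p $ snd p = v k $ fst p + v k $ snd p"] tight
    by blast
  have "inj_on \<kappa> T"
  proof (rule inj_onI)
    fix p q assume "p \<in> T" "q \<in> T" "\<kappa> p = \<kappa> q"
    then show "p = q"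
      using separate[of p q "v (\<kappa> p)"] dom \<kappa> by metis
  qed
  then have "card T \<le> card {..<r}"
    by (rule card_inj_on_le) (use \<kappa>(1) in auto)
  then show "enat (card T) \<le> enat r"
    by simp
qed

section \<open>Lower bound: matrices attaining the maximum\<close>

text \<open>Off the diagonal, the zeros form the complete bipartite graph between \<open>A\<close>
  and its complement; it has no edges for \<open>A = UNIV\<close>.\<close>

definition same_side_matrix :: "'n set \<Rightarrow> real ^ 'n ^ 'n" where
  "same_side_matrix A = (\<chi> i j. if i \<noteq> j \<and> (i \<in> A \<longleftrightarrow> j \<in> A) then 1 else 0)"

lemma same_side_matrix_nth:
  "same_side_matrix A $ i $ j = (if i \<noteq> j \<and> (i \<in> A \<longleftrightarrow> j \<in> A) then 1 else 0)"
  by (simp add: same_side_matrix_def)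

lemma transpose_same_side_matrix: "transpose (same_side_matrix A) = same_side_matrix A"
  by (auto simp: vec_eq_iff transpose_def same_side_matrix_nth)

lemma diagonal_le_same_side_matrix:
  "same_side_matrix A $ i $ i + same_side_matrix A $ j $ j \<le> 2 * same_side_matrix A $ i $ j"
  by (simp add: same_side_matrix_nth)

text \<open>A vector dominating \<open>same_side_matrix A\<close> vanishes at both ends of a zero entry where it is
  tight, and at no two distinct indices on the same side of \<open>A\<close>.\<close>

lemma symmetric_barvinok_rank_same_side_matrix_ge:
  fixes A :: "'n::finite set"
  assumes T: "T = Id \<and> A = UNIV \<or> T = A \<times> (- A)"
  shows "enat (card T) \<le> symmetric_barvinok_rank (same_side_matrix A)"
proof (rule symmetric_barvinok_rank_ge)
  fix p q and v :: "real ^ 'n"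
  assume pq: "p \<in> T" "q \<in> T"
    and dom: "\<forall>i j. same_side_matrix A $ i $ j \<le> v $ i + v $ j"
    and p: "same_side_matrix A $ fst p $ snd p = v $ fst p + v $ snd p"
    and q: "same_side_matrix A $ fst q $ snd q = v $ fst q + v $ snd q"
  have nonneg: "0 \<le> v $ i" for i
    using dom[rule_format, of i i] by (simp add: same_side_matrix_nth)
  have zero: "v $ fst s = 0 \<and> v $ snd s = 0"
    if "s \<in> T" "same_side_matrix A $ fst s $ snd s = v $ fst s + v $ snd s" for s
    using that T nonneg[of "fst s"] nonneg[of "snd s"]
    by (auto simp: same_side_matrix_nth add_nonneg_eq_0_iff split: if_splits)
  have eq: "i = j" if "v $ i = 0" "v $ j = 0" "i \<in> A \<longleftrightarrow> j \<in> A" for i j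
    using dom[rule_format, of i j] that by (auto simp: same_side_matrix_nth split: if_splits)
  \<comment> \<open>Corresponding components of \<open>p\<close> and \<open>q\<close> lie on the
    same side and are zeros of \<open>v\<close>, so \<open>eq\<close> identifies them.\<close>
  have "fst p \<in> A \<longleftrightarrow> fst q \<in> A" "snd p \<in> A \<longleftrightarrow> snd q \<in> A"
    using T pq by auto
  then show "p = q"
    using eq zero[OF pq(1) p] zero[OF pq(2) q] by (simp add: prod_eq_iff)
qed

lemma exists_symmetric_barvinok_rank_same_side_matrix_ge:
  "\<exists>A :: 'n::finite set. enat (max CARD('n) (CARD('n) ^ 2 div 4))
     \<le> symmetric_barvinok_rank (same_side_matrix A)"
proof (cases "CARD('n) ^ 2 div 4 \<le> CARD('n)")
  case True
  have "card (Id :: ('n \<times> 'n) set) = CARD('n)"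
    by (simp add: Id_def card_image inj_on_def full_SetCompr_eq)
  then show ?thesis
    using True symmetric_barvinok_rank_same_side_matrix_ge[of Id "UNIV :: 'n set"]
    by (auto simp: max_def)
next
  case False
  \<comment> \<open>A balanced split maximizes the number of pairs in
    \<open>A \<times> (- A)\<close>.\<close>
  obtain A :: "'n set" where A: "card A = CARD('n) div 2"
    using obtain_subset_with_card_n[of "CARD('n) div 2" "UNIV :: 'n set"] by auto
  have "card (A \<times> (- A)) = (CARD('n) div 2) * (CARD('n) - CARD('n) div 2)"
    using A by (simp add: card_cartesian_product Compl_eq_Diff_UNIV card_Diff_subset)
  also have "\<dots> = CARD('n) ^ 2 div 4"
  proof (cases "even CARD('n)")
    case True
    then obtain k where "CARD('n) = 2 * k"
      by blast
    then show ?thesis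
      by (simp add: power2_eq_square)
  next
    case False
    then obtain k where k: "CARD('n) = 2 * k + 1"
      using oddE by blast
    have "(2 * k + 1) ^ 2 = 4 * (k * (k + 1)) + 1"
      by (simp add: power2_eq_square algebra_simps)
    then show ?thesis
      using k by simp
  qed
  finally show ?thesis
    using False symmetric_barvinok_rank_same_side_matrix_ge[of "A \<times> (- A)" A]
    by (auto simp: max_def)
qed

theorem theorem3p6:
  shows "(\<forall>M :: real ^ 'n ^ 'n.
            transpose M = M \<and> (\<forall>i j. M $ i $ i + M $ j $ j \<le> 2 * M $ i $ j) \<longrightarrow>
            symmetric_barvinok_rank M \<le> enat (max CARD('n) (CARD('n) ^ 2 div 4)))
       \<and> (\<exists>M :: real ^ 'n ^ 'n.
            transpose M = M \<and> (\<forall>i j. M $ i $ i + M $ j $ j \<le> 2 * M $ i $ j) \<and>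
            symmetric_barvinok_rank M = enat (max CARD('n) (CARD('n) ^ 2 div 4)))
       \<and> (\<forall>M :: real ^ 'n ^ 'n.
            transpose M = M \<and> symmetric_barvinok_rank M < \<infinity> \<longrightarrow>
            symmetric_barvinok_rank M \<le> enat (max CARD('n) (CARD('n) ^ 2 div 4)))"
proof (intro conjI allI impI; (elim conjE)?)
  fix M :: "real ^ 'n ^ 'n"
  assume "transpose M = M" "\<forall>i j. M $ i $ i + M $ j $ j \<le> 2 * M $ i $ j"
  then show "symmetric_barvinok_rank M \<le> enat (max CARD('n) (CARD('n) ^ 2 div 4))"
    by (simp add: symmetric_barvinok_rank_le_quarter_square)
next
  obtain A :: "'n set" where
    "enat (max CARD('n) (CARD('n) ^ 2 div 4)) \<le> symmetric_barvinok_rank (same_side_matrix A)"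
    using exists_symmetric_barvinok_rank_same_side_matrix_ge by blast
  then show "\<exists>M :: real ^ 'n ^ 'n.
      transpose M = M \<and> (\<forall>i j. M $ i $ i + M $ j $ j \<le> 2 * M $ i $ j) \<and>
      symmetric_barvinok_rank M = enat (max CARD('n) (CARD('n) ^ 2 div 4))"
    by (intro exI[of _ "same_side_matrix A"] conjI allI antisym
        symmetric_barvinok_rank_le_quarter_square transpose_same_side_matrix
        diagonal_le_same_side_matrix)
next
  fix M :: "real ^ 'n ^ 'n"
  assume "transpose M = M" "symmetric_barvinok_rank M < \<infinity>"
  \<comment> \<open>Finite rank forces the diagonal inequality, so the first claim applies.\<close>
  then show "symmetric_barvinok_rank M \<le> enat (max CARD('n) (CARD('n) ^ 2 div 4))"
    by (intro symmetric_barvinok_rank_le_quarter_square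
        diagonal_le_of_symmetric_barvinok_rank_finite)
qed

end
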